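(* Let $X$ be the core of a cubelike graph. If $X'$ is a connected component of an orbital graph of $X$ that has degree $d$, then the eigenvalues of (the adjacency matrix of) $X'$ form a sub-multiset of the eigenvalues of the $d$-cube $Q_d$.
   Context: All graphs are finite, undirected and simple. A cubelike graph is a Cayley graph $\mathrm{Cay}(\mathbb{Z}_2^n,C)$, $0\notin C$ (vertex set $\mathbb{Z}_2^n$, $a\sim b$ iff $a+b\in C$). A graph is a core if all its endomorphisms are bijective; the core of a graph is the unique (up to isomorphism) core homomorphically equivalent to it. The orbitals of $\operatorname{Aut}(X)$ are its orbits on $V(X)\times V(X)$. An orbital graph of $X$ is a graph on $V(X)$ whose set of arcs (ordered pairs of adjacent vertices) is a symmetric union of non-diagonal orbitals of $\operatorname{Aut}(X)$. (The core of a cubelike graph is vertex transitive, so its orbital graphs are regular.) $Q_d=\mathrm{Cay}(\mathbb{Z}_2^d,\{e_1,\dots,e_d\})$ with $e_i$ the standard basis vectors. *)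

theory Defs
  imports
    "Graph_Theory.Graph_Theory"
    "Jordan_Normal_Form.Char_Poly"
    "HOL-Computational_Algebra.Polynomial"
    "HOL-Library.Z2"
    "HOL.Complex"
begin

text \<open>
  A finite simple graph is a \<^locale>\<open>pair_graph\<close>: finite vertex set, and a symmetric
  irreflexive set of ordered pairs \<^const>\<open>parcs\<close> (the arcs).  Vectors in $\mathbb{Z}_2^n$
  are the elements of \<^term>\<open>carrier_vec n :: bit vec set\<close>; this includes $n = 0$.
\<close>

definition graph_hom :: "('a \<Rightarrow> 'b) \<Rightarrow> 'a pair_pre_digraph \<Rightarrow> 'b pair_pre_digraph \<Rightarrow> bool" where
  "graph_hom f G H \<longleftrightarrow>
     (\<forall>u\<in>pverts G. f u \<in> pverts H) \<and> (\<forall>u v. (u, v) \<in> parcs G \<longrightarrow> (f u, f v) \<in> parcs H)"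

definition hom_equivalent :: "'a pair_pre_digraph \<Rightarrow> 'b pair_pre_digraph \<Rightarrow> bool" where
  "hom_equivalent G H \<longleftrightarrow> (\<exists>f. graph_hom f G H) \<and> (\<exists>g. graph_hom g H G)"

definition is_core :: "'a pair_pre_digraph \<Rightarrow> bool" where
  "is_core G \<longleftrightarrow> pair_graph G \<and> (\<forall>f. graph_hom f G G \<longrightarrow> bij_betw f (pverts G) (pverts G))"

text \<open>
  The core of a graph is determined only up to isomorphism, hence the relation; the vertex
  types of the two graphs may differ.
\<close>

definition core_of :: "'a pair_pre_digraph \<Rightarrow> 'b pair_pre_digraph \<Rightarrow> bool" where
  "core_of X G \<longleftrightarrow> is_core X \<and> hom_equivalent X G"

definition cayley :: "nat \<Rightarrow> bit vec set \<Rightarrow> bit vec pair_pre_digraph" where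
  "cayley n C = \<lparr> pverts = carrier_vec n,
     parcs = {(a, b). a \<in> carrier_vec n \<and> b \<in> carrier_vec n \<and> a + b \<in> C} \<rparr>"

definition cubelike :: "bit vec pair_pre_digraph \<Rightarrow> bool" where
  "cubelike G \<longleftrightarrow> (\<exists>n C. C \<subseteq> carrier_vec n \<and> 0\<^sub>v n \<notin> C \<and> G = cayley n C)"

lemma cubelike_imp_pair_graph:
  assumes "cubelike G"
  shows "pair_graph G"
proof -
  obtain n C where C: "0\<^sub>v n \<notin> C" and G: "G = cayley n C"
    using assms by (auto simp: cubelike_def)
  have fin: "finite (carrier_vec n :: bit vec set)"
  proof (rule finite_subset)
    show "(carrier_vec n :: bit vec set) \<subseteq> (\<lambda>xs. vec_of_list xs) ` {xs. set xs \<subseteq> UNIV \<and> length xs = n}"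
    proof
      fix v :: "bit vec" assume "v \<in> carrier_vec n"
      then have "v = vec_of_list (list_of_vec v)" "length (list_of_vec v) = n"
        by (simp_all add: vec_list)
      then show "v \<in> (\<lambda>xs. vec_of_list xs) ` {xs. set xs \<subseteq> UNIV \<and> length xs = n}" by blast
    qed
    have "(UNIV :: bit set) \<subseteq> {0, 1}" using bit.exhaust by auto
    then have "finite (UNIV :: bit set)" using finite_subset by blast
    then show "finite ((\<lambda>xs. vec_of_list xs) ` {xs :: bit list. set xs \<subseteq> UNIV \<and> length xs = n})"
      by (intro finite_imageI finite_lists_length_eq)
  qed
  have "v + v = 0\<^sub>v n" if "v \<in> carrier_vec n" for v :: "bit vec"
    using that by (intro eq_vecI) auto
  moreover have "finite (parcs (cayley n C))"
    by (rule finite_subset[OF _ finite_cartesian_product[OF fin fin]]) (auto simp: cayley_def)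
  ultimately show ?thesis
    unfolding G using fin C
    by unfold_locales
      (auto simp: cayley_def symmetric_def sym_def comm_add_vec)
qed

definition cube :: "nat \<Rightarrow> bit vec pair_pre_digraph" where
  "cube d = cayley d {unit_vec d i | i. i < d}"

definition automorphism :: "'a pair_pre_digraph \<Rightarrow> ('a \<Rightarrow> 'a) \<Rightarrow> bool" where
  "automorphism G f \<longleftrightarrow> bij_betw f (pverts G) (pverts G) \<and>
     (\<forall>u\<in>pverts G. \<forall>v\<in>pverts G. (f u, f v) \<in> parcs G \<longleftrightarrow> (u, v) \<in> parcs G)"

definition orbital :: "'a pair_pre_digraph \<Rightarrow> 'a \<times> 'a \<Rightarrow> ('a \<times> 'a) set" where
  "orbital G p = {(f (fst p), f (snd p)) | f. automorphism G f}"

definition orbitals :: "'a pair_pre_digraph \<Rightarrow> ('a \<times> 'a) set set" where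
  "orbitals G = orbital G ` (pverts G \<times> pverts G)"

text \<open>
  An orbital is diagonal if it consists of pairs \<open>(u, u)\<close>.  The union may be empty, in which
  case the orbital graph has no edges.
\<close>

definition orbital_graph :: "'a pair_pre_digraph \<Rightarrow> 'a pair_pre_digraph \<Rightarrow> bool" where
  "orbital_graph Y X \<longleftrightarrow> pverts Y = pverts X \<and> sym (parcs Y) \<and>
     (\<exists>S. S \<subseteq> {R \<in> orbitals X. \<not> R \<subseteq> Id} \<and> parcs Y = \<Union>S)"

definition connected_component :: "'a pair_pre_digraph \<Rightarrow> 'a pair_pre_digraph \<Rightarrow> bool" where
  "connected_component H G \<longleftrightarrow> pre_digraph.max_subgraph (with_proj G) connected (with_proj H)"

definition regular :: "'a pair_pre_digraph \<Rightarrow> nat \<Rightarrow> bool" where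
  "regular G d \<longleftrightarrow> (\<forall>v\<in>pverts G. out_degree (with_proj G) v = d)"

definition adj_matrix :: "'a pair_pre_digraph \<Rightarrow> 'a list \<Rightarrow> complex mat" where
  "adj_matrix G vs = mat (length vs) (length vs)
     (\<lambda>(i, j). if (vs ! i, vs ! j) \<in> parcs G then 1 else 0)"

text \<open>
  The multiset of eigenvalues, with algebraic multiplicities.  The adjacency matrix depends
  on an enumeration of the vertices, its eigenvalues do not: see \<open>graph_eigenvalues_eq\<close>.
\<close>

definition graph_eigenvalues :: "'a pair_pre_digraph \<Rightarrow> complex multiset" where
  "graph_eigenvalues G =
     proots (char_poly (adj_matrix G (SOME vs. distinct vs \<and> set vs = pverts G)))"

lemma char_poly_adj_matrix_eq:
  assumes "distinct vs" "distinct ws" "set vs = set ws"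
  shows "char_poly (adj_matrix G vs) = char_poly (adj_matrix G ws)"
proof -
  define n where "n = length vs"
  have n: "length vs = n" "length ws = n"
    using assms distinct_card unfolding n_def by metis+
  define P :: "complex mat" where
    "P = mat n n (\<lambda>(i, j). if vs ! i = ws ! j then 1 else 0)"
  define Q :: "complex mat" where
    "Q = mat n n (\<lambda>(i, j). if ws ! i = vs ! j then 1 else 0)"
  have vs_ex: "\<exists>k<n. vs ! k = ws ! j" if "j < n" for j
    using that n assms(3) by (metis in_set_conv_nth)
  have ws_ex: "\<exists>k<n. ws ! k = vs ! j" if "j < n" for j
    using that n assms(3) by (metis in_set_conv_nth)
  have pick: "(\<Sum>k<n. (if us ! k = x then 1 else 0) * h k) = h k0"
    if "distinct us" "length us = n" "k0 < n" "us ! k0 = x"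
    for us :: "'a list" and x k0 and h :: "nat \<Rightarrow> complex"
  proof -
    have "(\<Sum>k<n. (if us ! k = x then 1 else 0) * h k) = (\<Sum>k<n. if k = k0 then h k else 0)"
      using that by (intro sum.cong) (auto simp: nth_eq_iff_index_eq)
    then show ?thesis using that by simp
  qed
  have inv: "mat n n (\<lambda>(i, j). if us ! i = ts ! j then 1 else 0) *
             mat n n (\<lambda>(i, j). if ts ! i = us ! j then 1 else 0) = (1\<^sub>m n :: complex mat)"
    if us: "distinct us" "length us = n" and ts: "distinct ts" "length ts = n"
      and ex: "\<And>j. j < n \<Longrightarrow> \<exists>k<n. ts ! k = us ! j" for us ts :: "'a list"
  proof (rule eq_matI)
    fix i j assume ij: "i < dim_row (1\<^sub>m n :: complex mat)" "j < dim_col (1\<^sub>m n :: complex mat)"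
    then have ij: "i < n" "j < n" by auto
    obtain k0 where k0: "k0 < n" "ts ! k0 = us ! i" using ex ij by blast
    have "(\<Sum>k<n. (if ts ! k = us ! i then 1 else 0) * (if ts ! k = us ! j then 1 else 0))
        = (if ts ! k0 = us ! j then 1 else (0 :: complex))"
      by (rule pick[OF ts k0])
    also have "\<dots> = 1\<^sub>m n $$ (i, j)"
      using ij k0 us by (auto simp: nth_eq_iff_index_eq)
    finally show "(mat n n (\<lambda>(i, j). if us ! i = ts ! j then 1 else 0) *
             mat n n (\<lambda>(i, j). if ts ! i = us ! j then 1 else 0)) $$ (i, j) = (1\<^sub>m n :: complex mat) $$ (i, j)"
      using ij by (simp add: scalar_prod_def atLeast0LessThan eq_commute[of "us ! i"])
  qed auto
  have PQ: "P * Q = 1\<^sub>m n" unfolding P_def Q_def using assms n ws_ex by (intro inv) auto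
  have QP: "Q * P = 1\<^sub>m n" unfolding P_def Q_def using assms n vs_ex by (intro inv) auto
  have A: "adj_matrix G vs \<in> carrier_mat n n" "adj_matrix G ws \<in> carrier_mat n n"
    and PQc: "P \<in> carrier_mat n n" "Q \<in> carrier_mat n n"
    using n by (auto simp: adj_matrix_def P_def Q_def)
  have comm: "adj_matrix G vs * P = P * adj_matrix G ws"
  proof (rule eq_matI)
    fix i j assume "i < dim_row (P * adj_matrix G ws)" "j < dim_col (P * adj_matrix G ws)"
    then have ij: "i < n" "j < n" using A PQc by auto
    obtain k0 where k0: "k0 < n" "vs ! k0 = ws ! j" using vs_ex ij by blast
    obtain k1 where k1: "k1 < n" "ws ! k1 = vs ! i" using ws_ex ij by blast
    have "(adj_matrix G vs * P) $$ (i, j) = (\<Sum>k<n. (if vs ! k = ws ! j then 1 else 0) *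
        (if (vs ! i, vs ! k) \<in> parcs G then 1 else 0))"
      using ij n by (simp add: adj_matrix_def P_def scalar_prod_def atLeast0LessThan mult.commute)
    also have "\<dots> = (if (vs ! i, vs ! k0) \<in> parcs G then 1 else 0)"
      using assms n k0 by (intro pick) auto
    also have "\<dots> = (if (ws ! k1, ws ! j) \<in> parcs G then 1 else 0)"
      using k0 k1 by simp
    also have "\<dots> = (\<Sum>k<n. (if ws ! k = vs ! i then 1 else 0) *
        (if (ws ! k, ws ! j) \<in> parcs G then 1 else 0))"
      using assms n k1 by (intro pick[symmetric]) auto
    also have "\<dots> = (P * adj_matrix G ws) $$ (i, j)"
      using ij n by (simp add: adj_matrix_def P_def scalar_prod_def atLeast0LessThan
          eq_commute[of "vs ! i"])
    finally show "(adj_matrix G vs * P) $$ (i, j) = (P * adj_matrix G ws) $$ (i, j)" .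
  qed (use A PQc in auto)
  have "P * adj_matrix G ws * Q = adj_matrix G vs * (P * Q)"
    using A PQc by (simp flip: comm)
  then have "adj_matrix G vs = P * adj_matrix G ws * Q"
    using A PQ by simp
  then have "similar_mat (adj_matrix G vs) (adj_matrix G ws)"
    using A PQc PQ QP by (intro similar_matI[of _ _ P Q n]) auto
  then show ?thesis by (rule char_poly_similar)
qed

lemma graph_eigenvalues_eq:
  assumes "distinct vs" "set vs = pverts G"
  shows "graph_eigenvalues G = proots (char_poly (adj_matrix G vs))"
proof -
  have "\<exists>vs. distinct vs \<and> set vs = pverts G" using assms by blast
  from someI_ex[OF this] show ?thesis
    unfolding graph_eigenvalues_def using assms by (metis char_poly_adj_matrix_eq)
qed

end

theory Submission
  imports Defs
begin

text \<open>
  The component \<open>X'\<close> is covered by the cube \<open>Q\<^sub>d\<close>, and the eigenvalues of a quotient under a covering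
  are, with multiplicities, among those of the covering graph.

  The covering comes from translations.  Let \<open>f : X \<rightarrow> Z\<close> and \<open>g : Z \<rightarrow> X\<close> be homomorphisms between
  the core \<open>X\<close> and the cubelike graph \<open>Z = Cay(\<int>\<^sub>2\<^sup>n, C)\<close>.  For each \<open>a\<close> in \<open>\<int>\<^sub>2\<^sup>n\<close> the map
  \<open>\<sigma>\<^sub>a(u) = g(f u + a)\<close> is an endomorphism of \<open>X\<close>; since \<open>X\<close> is a core it is an automorphism, so it is
  also an automorphism of the orbital graph \<open>Y\<close>.  Fix a vertex \<open>x\<close> with \<open>Y\<close>-neighbours
  \<open>y\<^sub>1, \<dots>, y\<^sub>d\<close>, put \<open>c\<^sub>i = f x + f y\<^sub>i\<close>, and define \<open>p\<close> on \<open>\<int>\<^sub>2\<^sup>d\<close> by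
  \<open>p(q) = g(f x + \<Sum>\<^sub>i q\<^sub>i c\<^sub>i)\<close>.  With \<open>a = \<Sum>\<^sub>i q\<^sub>i c\<^sub>i\<close> we have \<open>p(q) = \<sigma>\<^sub>a(x)\<close>, and because
  \<open>f x + c\<^sub>i = f y\<^sub>i\<close> in characteristic two, \<open>p(q + e\<^sub>i) = \<sigma>\<^sub>a(y\<^sub>i)\<close>.  As \<open>\<sigma>\<^sub>a\<close> is an automorphism of \<open>Y\<close>,
  \<open>p\<close> maps the \<open>d\<close> neighbours of \<open>q\<close> bijectively onto the neighbours of \<open>p(q)\<close>; this is
  \<open>cube_local_bijection\<close>.  The image of \<open>p\<close> is a component of \<open>Y\<close>, because the cube is connected and
  arcs of \<open>Y\<close> lift along \<open>p\<close>, and it is \<open>X'\<close> once \<open>x\<close> is chosen with \<open>g(f x)\<close> in \<open>X'\<close>.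

  For a covering \<open>p\<close> with fibre indicator matrix \<open>S\<close>, local bijectivity says that the adjacency
  matrices satisfy \<open>A S = S B\<close>.  Since \<open>p\<close> is onto, \<open>S\<close> has full column rank and extends to a basis in
  which \<open>A\<close> is block triangular with \<open>B\<close> as a diagonal block, so the characteristic polynomial of \<open>B\<close>
  divides that of \<open>A\<close>; this is \<open>graph_eigenvalues_covering\<close>.
\<close>

section \<open>Intertwined matrices\<close>

lemma char_poly_four_block_lower_left_zero:
  fixes A1 :: "'a :: idom mat"
  assumes A1: "A1 \<in> carrier_mat n n" and A2: "A2 \<in> carrier_mat n m"
    and A4: "A4 \<in> carrier_mat m m"
  shows "char_poly (four_block_mat A1 A2 (0\<^sub>m m n) A4) = char_poly A1 * char_poly A4"
    (is "char_poly ?A = _")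
proof -
  let ?cm = "\<lambda>A. [:0, 1:] \<cdot>\<^sub>m 1\<^sub>m (dim_row A) + map_mat (\<lambda>a. [:- a:]) A"
  have "char_poly ?A = det (?cm ?A)"
    unfolding char_poly_defs using A1 A4 by simp
  also have "?cm ?A = four_block_mat (?cm A1) (map_mat (\<lambda>a. [:- a:]) A2) (0\<^sub>m m n) (?cm A4)"
    by (rule eq_matI) (use A1 A2 A4 in \<open>auto simp: one_poly_def\<close>)
  also have "det \<dots> = det (?cm A1) * det (?cm A4)"
    by (rule det_four_block_mat_lower_left_zero[of _ n _ m]) (use A1 A2 A4 in auto)
  finally show ?thesis
    unfolding char_poly_defs .
qed

text \<open>
  The two block equations say \<open>A S = S B\<close> for the matrix \<open>S\<close> with an identity block on top of \<open>R\<close>.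
  So the columns of \<open>S\<close> span an \<open>A\<close>-invariant subspace on which \<open>A\<close> acts as \<open>B\<close>.  The identity block
  makes the completion of \<open>S\<close> to an invertible matrix explicit: append the last \<open>k\<close> unit vectors.
\<close>

lemma char_poly_dvd_of_block_intertwining:
  fixes B :: "'a :: idom mat"
  assumes A11: "A11 \<in> carrier_mat m m" and A12: "A12 \<in> carrier_mat m k"
    and A21: "A21 \<in> carrier_mat k m" and A22: "A22 \<in> carrier_mat k k"
    and R: "R \<in> carrier_mat k m" and B: "B \<in> carrier_mat m m"
    and top: "A11 + A12 * R = B" and bottom: "A21 + A22 * R = R * B"
  shows "char_poly B dvd char_poly (four_block_mat A11 A12 A21 A22)"
proof -
  define A where "A = four_block_mat A11 A12 A21 A22"
  define P where "P = four_block_mat (1\<^sub>m m) (0\<^sub>m m k) R (1\<^sub>m k)"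
  define P' where "P' = four_block_mat (1\<^sub>m m) (0\<^sub>m m k) (- R) (1\<^sub>m k)"
  (* the action of A on the quotient by the invariant subspace *)
  define D where "D = A22 - R * A12"
  define M where "M = four_block_mat B A12 (0\<^sub>m k m) D"
  have D: "D \<in> carrier_mat k k"
    using A22 R A12 by (auto simp: D_def)
  have car: "A \<in> carrier_mat (m + k) (m + k)" "P \<in> carrier_mat (m + k) (m + k)"
    "P' \<in> carrier_mat (m + k) (m + k)" "M \<in> carrier_mat (m + k) (m + k)"
    using A11 A22 B D by (auto simp: A_def P_def P'_def M_def)
  have mR: "- R \<in> carrier_mat k m"
    using R by auto
  have canc: "R + - R = 0\<^sub>m k m" "- R + R = 0\<^sub>m k m"
    by (rule eq_matI; use R in auto)+
  (* the zero block of P times - R is simplified to this form *)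
  have neg0: "- 0\<^sub>m m m = (0\<^sub>m m m :: 'a mat)"
    by (rule eq_matI) auto
  have PP': "P * P' = 1\<^sub>m (m + k)"
    unfolding P_def P'_def
    by (subst mult_four_block_mat[of _ m m _ k _ k _ _ m _ k])
      (use R mR canc neg0 in auto)
  have P'P: "P' * P = 1\<^sub>m (m + k)"
    unfolding P_def P'_def
    by (subst mult_four_block_mat[of _ m m _ k _ k _ _ m _ k])
      (use R mR canc neg0 in auto)
  have RD: "R * A12 + D = A22"
    unfolding D_def by (rule eq_matI) (use R A12 A22 in auto)
  have "A * P = four_block_mat B A12 (R * B) A22"
    unfolding A_def P_def
    by (subst mult_four_block_mat[of _ m m _ k _ k _ _ m _ k])
      (use A11 A12 A21 A22 R top bottom in auto)
  also have "\<dots> = P * M"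
    unfolding M_def P_def
    by (subst mult_four_block_mat[of _ m m _ k _ k _ _ m _ k])
      (use A12 R B D RD in auto)
  finally have AP: "A * P = P * M" .
  have "A = A * (P * P')"
    unfolding PP' using car(1) by simp
  also have "\<dots> = P * M * P'"
    unfolding AP[symmetric] by (rule assoc_mult_mat[symmetric, OF car(1-3)])
  finally have "similar_mat A M"
    using car PP' P'P by (intro similar_matI[of _ _ P P' "m + k"]) auto
  then have "char_poly A = char_poly B * char_poly D"
    using char_poly_similar char_poly_four_block_lower_left_zero[OF B A12 D]
    by (metis M_def)
  then show ?thesis
    unfolding A_def by simp
qed


section \<open>Coverings and eigenvalues\<close>

definition covering :: "('a \<Rightarrow> 'b) \<Rightarrow> 'a pair_pre_digraph \<Rightarrow> 'b pair_pre_digraph \<Rightarrow> bool" where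
  "covering p G H \<longleftrightarrow> p ` pverts G = pverts H \<and>
     (\<forall>q\<in>pverts G. bij_betw p {r. (q, r) \<in> parcs G} {v. (p q, v) \<in> parcs H})"

lemma proots_mono_dvd:
  fixes p q :: "'a :: idom poly"
  assumes "p dvd q" "q \<noteq> 0"
  shows "proots p \<subseteq># proots q"
proof -
  obtain r where "q = p * r" using assms by auto
  then show ?thesis using assms by (auto simp: proots_mult)
qed

text \<open>
  Choose a section \<open>s\<close> of \<open>p\<close> and list the vertices of \<open>G\<close> with the image of \<open>s\<close> first, in the order of
  the vertices of \<open>H\<close>.  Then the fibre indicator matrix of \<open>p\<close> starts with an identity block, and the
  intertwining equation for the adjacency matrices only has to be checked entrywise: the entry at
  \<open>q\<close> and \<open>v\<close> counts the out-neighbours of \<open>q\<close> over \<open>v\<close> on one side, and is the adjacency of \<open>p q\<close> and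
  \<open>v\<close> on the other.
\<close>

lemma graph_eigenvalues_covering:
  fixes p :: "'a \<Rightarrow> 'b"
  assumes G: "pair_fin_digraph G" and p: "covering p G H"
  shows "graph_eigenvalues H \<subseteq># graph_eigenvalues G"
proof -
  interpret G: pair_fin_digraph G by fact
  have img: "p ` pverts G = pverts H"
    and bij: "\<And>q. q \<in> pverts G \<Longrightarrow> bij_betw p {r. (q, r) \<in> parcs G} {v. (p q, v) \<in> parcs H}"
    using p by (auto simp: covering_def)
  have fin: "finite (pverts G)" by (rule G.pair_finite_verts)
  define s where "s = inv_into (pverts G) p"
  have s: "s v \<in> pverts G" "p (s v) = v" if "v \<in> pverts H" for v
    using that unfolding s_def img[symmetric]
    by (rule inv_into_into, rule f_inv_into_f)
  have inj_s: "inj_on s (pverts H)"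
    by (rule inj_on_inverseI[of _ p]) (use s in auto)
  have "finite (pverts H)" using fin unfolding img[symmetric] by (rule finite_imageI)
  from finite_distinct_list[OF this]
  obtain ws where ws: "distinct ws" "set ws = pverts H"
    by (elim exE conjE)
  have "finite (pverts G - s ` pverts H)" using fin by simp
  from finite_distinct_list[OF this]
  obtain rs where rs: "distinct rs" "set rs = pverts G - s ` pverts H"
    by (elim exE conjE)
  define m where "m = length ws"
  define k where "k = length rs"
  define a :: "'a \<Rightarrow> 'a \<Rightarrow> complex" where "a q r = (if (q, r) \<in> parcs G then 1 else 0)" for q r
  define b :: "'b \<Rightarrow> 'b \<Rightarrow> complex" where "b v w = (if (v, w) \<in> parcs H then 1 else 0)" for v w
  have ws_in: "ws ! i \<in> pverts H" if "i < m" for i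
    using that nth_mem[of i ws] by (simp add: m_def ws(2))
  have rs_in: "rs ! i \<in> pverts G" if "i < k" for i
    using that nth_mem[of i rs] by (simp add: k_def rs(2))
  have fibre_sum: "(\<Sum>r\<in>pverts G. a q r * (if p r = v then 1 else 0)) = b (p q) v"
    if q: "q \<in> pverts G" for q v
  proof -
    have "(\<Sum>r\<in>pverts G. a q r * (if p r = v then 1 else 0))
        = (\<Sum>r | (q, r) \<in> parcs G. if p r = v then 1 else 0)"
      using fin by (intro sum.mono_neutral_cong_right) (auto simp: a_def dest: G.in_arcsD2)
    also have "\<dots> = (\<Sum>w | (p q, w) \<in> parcs H. if w = v then 1 else 0)"
      by (rule sum.reindex_bij_betw[OF bij[OF q]])
    also have "\<dots> = b (p q) v"
    proof -
      have "finite {r. (q, r) \<in> parcs G}"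
        using fin by (rule rev_finite_subset) (auto dest: G.in_arcsD2)
      then have "finite {w. (p q, w) \<in> parcs H}"
        using bij[OF q] bij_betw_finite by blast
      then show ?thesis by (simp add: b_def)
    qed
    finally show ?thesis .
  qed
  (* separates the one vertex of the section over v from the rest of its fibre *)
  have split: "a q (s v) + (\<Sum>l<k. a q (rs ! l) * (if p (rs ! l) = v then 1 else 0)) = b (p q) v"
    if q: "q \<in> pverts G" and v: "v \<in> pverts H" for q v
  proof -
    let ?h = "\<lambda>r. a q r * (if p r = v then 1 else 0)"
    have "(\<Sum>l<k. ?h (rs ! l)) = sum ?h (set rs)"
      using sum.reindex_bij_betw[OF bij_betw_nth[OF rs(1) refl refl], of ?h] by (simp add: k_def)
    moreover have "sum ?h (s ` pverts H) = a q (s v)"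
    proof -
      have "sum ?h (s ` pverts H) = (\<Sum>w\<in>pverts H. if w = v then a q (s v) else 0)"
        using s by (subst sum.reindex[OF inj_s]) (auto intro!: sum.cong)
      then show ?thesis using v \<open>finite (pverts H)\<close> by simp
    qed
    moreover have "sum ?h (pverts G) = sum ?h (set rs) + sum ?h (s ` pverts H)"
      unfolding rs(2) by (rule sum.subset_diff) (use fin s in auto)
    ultimately show ?thesis using fibre_sum[OF q, of v] by simp
  qed
  define A11 where "A11 = mat m m (\<lambda>(i, j). a (s (ws ! i)) (s (ws ! j)))"
  define A12 where "A12 = mat m k (\<lambda>(i, j). a (s (ws ! i)) (rs ! j))"
  define A21 where "A21 = mat k m (\<lambda>(i, j). a (rs ! i) (s (ws ! j)))"
  define A22 where "A22 = mat k k (\<lambda>(i, j). a (rs ! i) (rs ! j))"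
  define R :: "complex mat" where "R = mat k m (\<lambda>(i, j). if p (rs ! i) = ws ! j then 1 else 0)"
  define B where "B = mat m m (\<lambda>(i, j). b (ws ! i) (ws ! j))"
  note defs = A11_def A12_def A21_def A22_def R_def B_def
  have top: "A11 + A12 * R = B"
    by (rule eq_matI)
      (auto simp: defs scalar_prod_def atLeast0LessThan ws_in s split)
  have bottom: "A21 + A22 * R = R * B"
  proof (rule eq_matI)
    fix i j assume "i < dim_row (R * B)" "j < dim_col (R * B)"
    then have ij: "i < k" "j < m" by (auto simp: defs)
    have "p (rs ! i) \<in> set ws" using rs_in[OF ij(1)] img ws by blast
    then obtain l0 where l0: "l0 < m" "ws ! l0 = p (rs ! i)"
      by (auto simp: in_set_conv_nth m_def)
    have "(R * B) $$ (i, j)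
        = (\<Sum>l<m. (if p (rs ! i) = ws ! l then 1 else 0) * b (ws ! l) (ws ! j))"
      using ij by (simp add: defs scalar_prod_def atLeast0LessThan)
    also have "\<dots> = (\<Sum>l<m. if l = l0 then b (p (rs ! i)) (ws ! j) else 0)"
      using l0 ws(1) by (intro sum.cong) (auto simp: m_def nth_eq_iff_index_eq simp flip: l0(2))
    also have "\<dots> = b (p (rs ! i)) (ws ! j)" using l0 by simp
    also have "\<dots> = (A21 + A22 * R) $$ (i, j)"
      using ij split[OF rs_in[OF ij(1)] ws_in[OF ij(2)]]
      by (simp add: defs scalar_prod_def atLeast0LessThan)
    finally show "(A21 + A22 * R) $$ (i, j) = (R * B) $$ (i, j)" by simp
  qed (auto simp: defs)
  have "char_poly B dvd char_poly (four_block_mat A11 A12 A21 A22)"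
    by (rule char_poly_dvd_of_block_intertwining[OF _ _ _ _ _ _ top bottom])
      (auto simp: defs)
  moreover have "B = adj_matrix H ws"
    by (rule eq_matI) (auto simp: defs adj_matrix_def m_def b_def)
  moreover have "four_block_mat A11 A12 A21 A22 = adj_matrix G (map s ws @ rs)"
    by (rule eq_matI) (auto simp: defs adj_matrix_def m_def k_def a_def nth_append)
  ultimately have dvd: "char_poly (adj_matrix H ws) dvd char_poly (adj_matrix G (map s ws @ rs))"
    by simp
  have "adj_matrix G (map s ws @ rs) \<in> carrier_mat (m + k) (m + k)"
    by (simp add: adj_matrix_def m_def k_def)
  then have "char_poly (adj_matrix G (map s ws @ rs)) \<noteq> 0"
    by (auto dest!: degree_monic_char_poly)
  then have "proots (char_poly (adj_matrix H ws))
      \<subseteq># proots (char_poly (adj_matrix G (map s ws @ rs)))"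
    by (rule proots_mono_dvd[OF dvd])
  moreover have "distinct (map s ws @ rs)" "set (map s ws @ rs) = pverts G"
    using ws rs inj_s s by (auto simp: distinct_map)
  ultimately show ?thesis
    using graph_eigenvalues_eq ws by metis
qed


section \<open>Automorphisms and orbital graphs\<close>

text \<open>
  By finiteness: \<open>h\<close> induces an injection of the finite arc set into itself, hence a surjection, so
  non-arcs cannot be mapped to arcs.
\<close>

lemma bij_hom_imp_automorphism:
  assumes fin: "finite (parcs G)" and wf: "parcs G \<subseteq> pverts G \<times> pverts G"
    and bij: "bij_betw h (pverts G) (pverts G)"
    and hom: "\<And>u v. (u, v) \<in> parcs G \<Longrightarrow> (h u, h v) \<in> parcs G"
  shows "automorphism G h"
proof -
  have inj: "inj_on h (pverts G)" using bij by (rule bij_betw_imp_inj_on)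
  have "inj_on (map_prod h h) (parcs G)"
    by (rule inj_on_subset[OF map_prod_inj_on[OF inj inj] wf])
  moreover have "map_prod h h ` parcs G \<subseteq> parcs G" using hom by auto
  ultimately have surj: "map_prod h h ` parcs G = parcs G"
    by (simp add: endo_inj_surj fin)
  have "(u, v) \<in> parcs G" if "(h u, h v) \<in> parcs G" "u \<in> pverts G" "v \<in> pverts G" for u v
  proof -
    have "(h u, h v) \<in> map_prod h h ` parcs G" using that surj by simp
    then obtain u' v' where uv: "(u', v') \<in> parcs G" "h u' = h u" "h v' = h v" by auto
    then have "u' = u" "v' = v" using inj wf that by (auto dest: inj_onD)
    then show ?thesis using uv by simp
  qed
  then show ?thesis using bij hom unfolding automorphism_def by blast
qed

lemma core_endomorphism_automorphism:
  assumes X: "is_core X" and h: "graph_hom h X X"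
  shows "automorphism X h"
proof -
  interpret pair_graph X using X by (simp add: is_core_def)
  show ?thesis
  proof (rule bij_hom_imp_automorphism)
    show "parcs X \<subseteq> pverts X \<times> pverts X"
      by (auto dest: in_arcsD1 in_arcsD2)
    show "bij_betw h (pverts X) (pverts X)"
      using X h by (simp add: is_core_def)
    show "(h u, h v) \<in> parcs X" if "(u, v) \<in> parcs X" for u v
      using h that unfolding graph_hom_def by blast
  qed (rule pair_finite_arcs)
qed

lemma automorphism_comp:
  assumes "automorphism G h" "automorphism G k"
  shows "automorphism G (h \<circ> k)"
proof -
  have "k u \<in> pverts G" if "u \<in> pverts G" for u
    using assms(2) that bij_betwE[of k "pverts G" "pverts G"] by (simp add: automorphism_def)
  moreover have "bij_betw (h \<circ> k) (pverts G) (pverts G)"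
    using assms by (intro bij_betw_trans[of k _ "pverts G"]) (simp_all add: automorphism_def)
  ultimately show ?thesis
    using assms unfolding automorphism_def comp_apply by blast
qed

lemma orbital_graph_wf:
  assumes "orbital_graph Y X"
  shows "parcs Y \<subseteq> pverts Y \<times> pverts Y"
proof clarify
  fix u v assume "(u, v) \<in> parcs Y"
  then obtain R where "R \<in> orbitals X" "(u, v) \<in> R"
    using assms unfolding orbital_graph_def by blast
  then obtain a b where "a \<in> pverts X" "b \<in> pverts X" "(u, v) \<in> orbital X (a, b)"
    by (auto simp: orbitals_def)
  then obtain h where "automorphism X h" "u = h a" "v = h b"
    by (auto simp: orbital_def)
  then have "u \<in> pverts X" "v \<in> pverts X"
    using \<open>a \<in> pverts X\<close> \<open>b \<in> pverts X\<close> bij_betwE[of h "pverts X" "pverts X"]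
    by (simp_all add: automorphism_def)
  then show "u \<in> pverts Y \<and> v \<in> pverts Y"
    using assms by (simp add: orbital_graph_def)
qed

text \<open>
  Each orbital is invariant under composition with \<open>h\<close>, so \<open>h\<close> maps arcs of \<open>Y\<close> to arcs of \<open>Y\<close>.
\<close>

lemma orbital_graph_automorphism:
  assumes X: "finite (pverts X)" and Y: "orbital_graph Y X" and h: "automorphism X h"
  shows "automorphism Y h"
proof (rule bij_hom_imp_automorphism)
  have V: "pverts Y = pverts X" using Y by (simp add: orbital_graph_def)
  show wf: "parcs Y \<subseteq> pverts Y \<times> pverts Y" by (rule orbital_graph_wf[OF Y])
  show "finite (parcs Y)"
    by (rule finite_subset[OF wf]) (simp add: V X)
  show "bij_betw h (pverts Y) (pverts Y)" using h V by (simp add: automorphism_def)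
  fix u v assume uv: "(u, v) \<in> parcs Y"
  obtain S where S: "S \<subseteq> {R \<in> orbitals X. \<not> R \<subseteq> Id}" "parcs Y = \<Union>S"
    using Y by (auto simp: orbital_graph_def)
  obtain R where R: "R \<in> S" "(u, v) \<in> R" using uv S(2) by blast
  then have "R \<in> orbitals X" using S(1) by blast
  then obtain q where "R = orbital X q" by (auto simp: orbitals_def)
  then have q: "orbital X q \<in> S" "(u, v) \<in> orbital X q" using R by simp_all
  then obtain k where k: "automorphism X k" "u = k (fst q)" "v = k (snd q)"
    by (auto simp: orbital_def)
  then have "(h u, h v) \<in> orbital X q"
    using automorphism_comp[OF h k(1)] unfolding orbital_def k(2,3)
    by (intro CollectI exI[of _ "h \<circ> k"]) simp
  then show "(h u, h v) \<in> parcs Y" using S q by blast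
qed

lemma automorphism_bij_betw_neighbours:
  assumes wf: "parcs G \<subseteq> pverts G \<times> pverts G" and h: "automorphism G h" and u: "u \<in> pverts G"
  shows "bij_betw h {v. (u, v) \<in> parcs G} {v. (h u, v) \<in> parcs G}"
proof -
  have bij: "bij_betw h (pverts G) (pverts G)"
    and iff: "\<And>u v. u \<in> pverts G \<Longrightarrow> v \<in> pverts G \<Longrightarrow> (h u, h v) \<in> parcs G \<longleftrightarrow> (u, v) \<in> parcs G"
    using h by (auto simp: automorphism_def)
  have "{v. (h u, v) \<in> parcs G} \<subseteq> h ` {v. (u, v) \<in> parcs G}"
  proof
    fix w assume "w \<in> {v. (h u, v) \<in> parcs G}"
    then have w: "(h u, w) \<in> parcs G" by simp
    then obtain v where "v \<in> pverts G" "w = h v"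
      using wf bij by (auto simp: bij_betw_def)
    then show "w \<in> h ` {v. (u, v) \<in> parcs G}" using w iff[OF u] by auto
  qed
  then show ?thesis
    using wf iff[OF u] bij by (auto simp: bij_betw_def intro: inj_on_subset)
qed


section \<open>Local bijections from the cube\<close>

lemma bit_vec_add_self:
  fixes v :: "bit vec"
  shows "v \<in> carrier_vec n \<Longrightarrow> v + v = 0\<^sub>v n"
  by (intro eq_vecI) auto

lemma bit_vec_add_cancel:
  fixes u v :: "bit vec"
  assumes "u \<in> carrier_vec n" "v \<in> carrier_vec n"
  shows "u + (u + v) = v"
  using assms bit_vec_add_self[of u n]
  by (simp flip: assoc_add_vec[of _ n])

lemma cayley_translation_hom:
  assumes a: "a \<in> carrier_vec n"
  shows "graph_hom (\<lambda>u. u + a) (cayley n C) (cayley n C)"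
proof -
  have "(u + a) + (v + a) = u + v" if "u \<in> carrier_vec n" "v \<in> carrier_vec n" for u v
    by (rule eq_vecI) (use that a in \<open>auto simp: algebra_simps\<close>)
  then show ?thesis using a by (auto simp: graph_hom_def cayley_def)
qed

lemma cubelike_cube: "cubelike (cube d)"
  unfolding cubelike_def cube_def
  by (intro exI[of _ d] exI[of _ "{unit_vec d i | i. i < d}"])
    (auto dest: sym)

lemma bij_betw_cube_neighbours:
  assumes q: "q \<in> carrier_vec d"
  shows "bij_betw (\<lambda>i. q + unit_vec d i) {..<d} {r. (q, r) \<in> parcs (cube d)}"
proof (rule bij_betwI')
  fix i j assume ij: "i \<in> {..<d}" "j \<in> {..<d}"
  show "q + unit_vec d i = q + unit_vec d j \<longleftrightarrow> i = j"
  proof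
    assume "q + unit_vec d i = q + unit_vec d j"
    then have "q + (q + unit_vec d i) = q + (q + unit_vec d j)" by simp
    then have "(unit_vec d i :: bit vec) = unit_vec d j"
      using q by (simp add: bit_vec_add_cancel[of _ d])
    then show "i = j" using ij by simp
  qed simp
next
  fix i assume "i \<in> {..<d}"
  then show "q + unit_vec d i \<in> {r. (q, r) \<in> parcs (cube d)}"
    using q by (auto simp: cube_def cayley_def bit_vec_add_cancel[of _ d])
next
  fix r assume "r \<in> {r. (q, r) \<in> parcs (cube d)}"
  then obtain i where i: "i < d" "r \<in> carrier_vec d" "q + r = unit_vec d i"
    by (auto simp: cube_def cayley_def)
  then have "r = q + unit_vec d i"
    using bit_vec_add_cancel[OF q, of r] by simp
  then show "\<exists>i\<in>{..<d}. r = q + unit_vec d i" using i by auto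
qed

lemma mult_mat_vec_unit_vec:
  fixes A :: "'a :: semiring_1 mat"
  assumes "A \<in> carrier_mat n d" "i < d"
  shows "A *\<^sub>v unit_vec d i = col A i"
  by (rule eq_vecI) (use assms in auto)

text \<open>
  The heart of the argument: \<open>p q = g (f x + T q)\<close>, where \<open>T\<close> is the linear map sending the \<open>i\<close>-th unit
  vector to \<open>f x + f (ys i)\<close>, for \<open>ys\<close> an enumeration of the neighbours of \<open>x\<close>.  Near \<open>q\<close>, the map
  \<open>p\<close> looks like the automorphism \<open>u \<mapsto> g (f u + T q)\<close> of \<open>Y\<close> near \<open>x\<close>.
\<close>

lemma cube_local_bijection:
  fixes X Y :: "'a pair_pre_digraph"
  assumes X: "is_core X"
    and f: "graph_hom f X (cayley n C)" and g: "graph_hom g (cayley n C) X"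
    and Y: "orbital_graph Y X" and x: "x \<in> pverts X"
    and deg: "card {y. (x, y) \<in> parcs Y} = d"
  obtains p where "p (0\<^sub>v d) = g (f x)"
    and "\<And>q. q \<in> carrier_vec d \<Longrightarrow>
      bij_betw p {r. (q, r) \<in> parcs (cube d)} {y. (p q, y) \<in> parcs Y}"
proof -
  interpret X: pair_graph X using X by (simp add: is_core_def)
  have V: "pverts Y = pverts X" using Y by (simp add: orbital_graph_def)
  note wf = orbital_graph_wf[OF Y]
  have fc: "f u \<in> carrier_vec n" if "u \<in> pverts X" for u
    using f that by (auto simp: graph_hom_def cayley_def)
  have auto_Y: "automorphism Y (\<lambda>u. g (f u + a))" if a: "a \<in> carrier_vec n" for a
  proof (rule orbital_graph_automorphism[OF X.pair_finite_verts Y])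
    have "graph_hom (\<lambda>u. g (f u + a)) X X"
      using f g cayley_translation_hom[OF a, of C] unfolding graph_hom_def by auto
    then show "automorphism X (\<lambda>u. g (f u + a))"
      by (rule core_endomorphism_automorphism[OF X])
  qed
  have "finite {y. (x, y) \<in> parcs Y}"
    by (rule finite_subset[of _ "pverts X"]) (use wf V X.pair_finite_verts in auto)
  then obtain ys where ys: "bij_betw ys {..<d} {y. (x, y) \<in> parcs Y}"
    using ex_bij_betw_nat_finite deg by (metis atLeast0LessThan)
  then have ys_in: "ys i \<in> pverts X" if "i < d" for i
    using that wf V by (fastforce dest: bij_betwE)
  define T where "T = mat_of_cols n (map (\<lambda>i. f x + f (ys i)) [0..<d])"
  have T: "T \<in> carrier_mat n d" by (auto simp: T_def)
  have T_unit: "T *\<^sub>v unit_vec d i = f x + f (ys i)" if "i < d" for i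
    using that T fc x ys_in by (simp add: mult_mat_vec_unit_vec T_def)
  define p where "p q = g (f x + T *\<^sub>v q)" for q
  have Tc: "T *\<^sub>v q \<in> carrier_vec n" if "q \<in> carrier_vec d" for q
    using T that by simp
  have p_step: "p (q + unit_vec d i) = g (f (ys i) + T *\<^sub>v q)"
    if q: "q \<in> carrier_vec d" and i: "i < d" for q i
  proof -
    have "f x + T *\<^sub>v (q + unit_vec d i) = f x + (T *\<^sub>v q + (f x + f (ys i)))"
      using T q i by (simp add: mult_add_distrib_mat_vec[of _ n d] T_unit)
    (* the two summands f x cancel in characteristic two *)
    also have "\<dots> = f (ys i) + T *\<^sub>v q"
      by (rule eq_vecI) (use T fc[OF x] fc[OF ys_in[OF i]] in auto)
    finally show ?thesis by (simp add: p_def)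
  qed
  show thesis
  proof (rule that[of p])
    show "p (0\<^sub>v d) = g (f x)"
    proof -
      have "T *\<^sub>v 0\<^sub>v d = 0\<^sub>v n" by (rule eq_vecI) (use T in auto)
      then show ?thesis using fc[OF x] by (simp add: p_def)
    qed
    fix q :: "bit vec" assume q: "q \<in> carrier_vec d"
    let ?h = "\<lambda>u. g (f u + T *\<^sub>v q)"
    have h: "automorphism Y ?h" by (rule auto_Y[OF Tc[OF q]])
    have "bij_betw (?h \<circ> ys) {..<d} {y. (p q, y) \<in> parcs Y}"
      using automorphism_bij_betw_neighbours[OF wf h] x V ys
      by (auto simp: p_def intro: bij_betw_trans)
    (* both maps on indices send i to the image of the i-th neighbour of x *)
    then have "bij_betw (p \<circ> (\<lambda>i. q + unit_vec d i)) {..<d} {y. (p q, y) \<in> parcs Y}"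
      by (rule iffD1[OF bij_betw_cong, rotated]) (use p_step[OF q] in auto)
    then show "bij_betw p {r. (q, r) \<in> parcs (cube d)} {y. (p q, y) \<in> parcs Y}"
      using bij_betw_cube_neighbours[OF q] bij_betw_comp_iff by blast
  qed
qed

text \<open>
  Connectedness of the cube as an induction rule: flipping a nonzero coordinate reduces the number
  of nonzero coordinates.
\<close>

lemma cube_induct_arc [consumes 1, case_names zero arc]:
  assumes "q \<in> carrier_vec d" and zero: "P (0\<^sub>v d)"
    and arc: "\<And>q r. (q, r) \<in> parcs (cube d) \<Longrightarrow> P q \<Longrightarrow> P r"
  shows "P q"
  using assms(1)
proof (induction "card {i. i < d \<and> q $ i \<noteq> 0}" arbitrary: q)
  case 0
  then have "q = 0\<^sub>v d" by (intro eq_vecI) auto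
  then show ?case using zero by simp
next
  case (Suc k)
  then have "{i. i < d \<and> q $ i \<noteq> 0} \<noteq> {}" by (metis card.empty nat.distinct(1))
  then obtain i where i: "i < d" "q $ i \<noteq> 0" by auto
  define q' where "q' = q + unit_vec d i"
  have q': "q' \<in> carrier_vec d" using Suc.prems by (simp add: q'_def)
  have "{j. j < d \<and> q' $ j \<noteq> 0} = {j. j < d \<and> q $ j \<noteq> 0} - {i}"
    using i Suc.prems by (auto simp: q'_def unit_vec_def)
  then have "k = card {j. j < d \<and> q' $ j \<noteq> 0}"
    using i Suc.hyps(2) by simp
  then have "P q'" by (rule Suc.hyps(1)[OF _ q'])
  moreover have "q' + q = unit_vec d i"
    using Suc.prems bit_vec_add_cancel[of q d "unit_vec d i"]
    by (simp add: q'_def comm_add_vec[of _ d q])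
  then have "(q', q) \<in> parcs (cube d)"
    using i q' Suc.prems by (auto simp: cube_def cayley_def)
  ultimately show ?case by (rule arc[rotated])
qed


section \<open>Connected components\<close>

text \<open>
  If the arc from \<open>u\<close> to \<open>v\<close> were missing from \<open>H\<close>, adding it, together with \<open>v\<close>, would give a larger
  subgraph that is still connected, against maximality.
\<close>

lemma connected_component_closed:
  assumes H: "connected_component H G" and u: "u \<in> pverts H" and uv: "(u, v) \<in> parcs G"
  shows "(u, v) \<in> parcs H"
proof -
  have sub: "subgraph (with_proj H) (with_proj G)" and con: "connected (with_proj H)"
    and max: "\<And>H'. subgraph (with_proj H) H' \<Longrightarrow> subgraph H' (with_proj G) \<Longrightarrow> connected H'
        \<Longrightarrow> H' = with_proj H"
    using H unfolding connected_component_def pre_digraph.max_subgraph_def by blast+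
  have wfG: "pair_wf_digraph G" and wfH: "pair_wf_digraph H"
    using sub by (auto simp: subgraph_def wf_digraph_wp_iff)
  interpret G: pair_wf_digraph G by fact
  interpret H: pair_wf_digraph H by fact
  define K where "K = \<lparr> pverts = insert v (pverts H), parcs = insert (u, v) (parcs H) \<rparr>"
  have wfK: "pair_wf_digraph K"
    using u H.in_arcsD1 H.in_arcsD2 by unfold_locales (auto simp: K_def)
  have HK: "subgraph (with_proj H) (with_proj K)"
    using wfH wfK by (auto simp: subgraph_def wf_digraph_wp_iff K_def)
  have KG: "subgraph (with_proj K) (with_proj G)"
    using sub wfK uv G.in_arcsD2 by (auto simp: subgraph_def wf_digraph_wp_iff K_def)
  interpret K: pair_wf_digraph "mk_symmetric (with_proj K)"
    using wfK by (simp add: wf_digraph.wellformed_mk_symmetric wf_digraph_wp_iff)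
  have mono: "a \<rightarrow>\<^sup>*\<^bsub>with_proj (mk_symmetric (with_proj K))\<^esub> b"
    if "a \<in> pverts H" "b \<in> pverts H" for a b
  proof -
    have "a \<rightarrow>\<^sup>*\<^bsub>with_proj (mk_symmetric (with_proj H))\<^esub> b"
      using con that by (auto simp: connected_def strongly_connected_def)
    then show ?thesis
      unfolding reachable_def
      by (rule rtrancl_on_mono[rotated 2]) (auto simp: K_def parcs_mk_symmetric)
  qed
  have "u \<rightarrow>\<^sup>*\<^bsub>with_proj (mk_symmetric (with_proj K))\<^esub> v"
    "v \<rightarrow>\<^sup>*\<^bsub>with_proj (mk_symmetric (with_proj K))\<^esub> u"
    by (intro K.reachable_adjI; force simp: K_def parcs_mk_symmetric)+
  then have hub: "a \<rightarrow>\<^sup>*\<^bsub>with_proj (mk_symmetric (with_proj K))\<^esub> u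
      \<and> u \<rightarrow>\<^sup>*\<^bsub>with_proj (mk_symmetric (with_proj K))\<^esub> a"
    if "a \<in> pverts K" for a
    using that mono[OF u] mono[OF _ u] by (auto simp: K_def)
  have "connected (with_proj K)"
    unfolding connected_def
  proof (rule strongly_connectedI)
    show "verts (with_proj (mk_symmetric (with_proj K))) \<noteq> {}" by (simp add: K_def)
    fix a b
    assume "a \<in> verts (with_proj (mk_symmetric (with_proj K)))"
      "b \<in> verts (with_proj (mk_symmetric (with_proj K)))"
    then have "a \<in> pverts K" "b \<in> pverts K" by simp_all
    then show "a \<rightarrow>\<^sup>*\<^bsub>with_proj (mk_symmetric (with_proj K))\<^esub> b"
      using hub by (blast intro: K.reachable_trans)
  qed
  from max[OF HK KG this] have "parcs K = parcs H"
    by (metis with_proj_simps(2))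
  then show ?thesis by (auto simp: K_def)
qed

lemma connected_component_induct [consumes 4, case_names base arc]:
  assumes H: "connected_component H G" and sym: "sym (parcs G)"
    and u: "u \<in> pverts H" and v: "v \<in> pverts H"
    and base: "P u" and arc: "\<And>x y. (x, y) \<in> parcs G \<Longrightarrow> P x \<Longrightarrow> P y"
  shows "P v"
proof -
  have sub: "parcs H \<subseteq> parcs G" and con: "connected (with_proj H)"
    and "wf_digraph (with_proj H)"
    using H unfolding connected_component_def pre_digraph.max_subgraph_def
    by (auto simp: subgraph_def)
  then have wf: "wf_digraph (with_proj (mk_symmetric (with_proj H)))"
    by (simp add: wf_digraph.wellformed_mk_symmetric wf_digraph_wp_iff)
  have "u \<rightarrow>\<^sup>*\<^bsub>with_proj (mk_symmetric (with_proj H))\<^esub> v"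
    using con u v by (auto simp: connected_def strongly_connected_def)
  with wf show ?thesis
  proof (induction rule: wf_digraph.reachable_induct[consumes 2, case_names base step])
    case (step x y)
    then have "(x, y) \<in> parcs G"
      using sub sym by (auto simp: parcs_mk_symmetric dest: symD)
    then show ?case using step arc by blast
  qed (rule base)
qed


section \<open>Orbital graphs of cores of cubelike graphs\<close>

theorem corollary7p4:
  fixes Z :: "bit vec pair_pre_digraph" and X Y X' :: "'a pair_pre_digraph" and d :: nat
  assumes "cubelike Z" and "core_of X Z"
    and "orbital_graph Y X" and "connected_component X' Y" and "regular X' d"
  shows "graph_eigenvalues X' \<subseteq># graph_eigenvalues (cube d)"
proof -
  obtain n C where Z: "Z = cayley n C"
    using assms(1) by (auto simp: cubelike_def)
  have X: "is_core X" using assms(2) by (simp add: core_of_def)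
  obtain f g where f: "graph_hom f X (cayley n C)" and g: "graph_hom g (cayley n C) X"
    using assms(2) Z by (auto simp: core_of_def hom_equivalent_def)
  interpret X: pair_graph X using X by (simp add: is_core_def)
  note Y = assms(3) and comp = assms(4)
  have V: "pverts Y = pverts X" and sym: "sym (parcs Y)"
    using Y by (auto simp: orbital_graph_def)
  have sub: "pverts X' \<subseteq> pverts Y" "parcs X' \<subseteq> parcs Y" and wfX': "pair_wf_digraph X'"
    and ne: "pverts X' \<noteq> {}"
    using comp unfolding connected_component_def pre_digraph.max_subgraph_def
    by (auto simp: subgraph_def connected_def strongly_connected_def wf_digraph_wp_iff)
  interpret X': pair_wf_digraph X' by fact
  have nbrs: "{y. (v, y) \<in> parcs X'} = {y. (v, y) \<in> parcs Y}" if "v \<in> pverts X'" for v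
    using connected_component_closed[OF comp that] sub by auto
  (* The covering maps the zero vector to g (f x), so x is chosen with g (f x) in X'.
     Since g o f is an automorphism of Y, x has the same degree in Y as that vertex. *)
  obtain x0 where x0: "x0 \<in> pverts X'" using ne by auto
  have "graph_hom (g \<circ> f) X X"
    using f g by (auto simp: graph_hom_def)
  then have gf: "automorphism X (g \<circ> f)"
    by (rule core_endomorphism_automorphism[OF X])
  then obtain x where x: "x \<in> pverts X" "g (f x) = x0"
    using x0 sub V unfolding automorphism_def bij_betw_def by (metis comp_apply imageE subsetD)
  have "card {y. (x, y) \<in> parcs Y} = card {y. (x0, y) \<in> parcs Y}"
    using automorphism_bij_betw_neighbours[OF orbital_graph_wf[OF Y]
        orbital_graph_automorphism[OF X.pair_finite_verts Y gf], of x] x V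
    by (auto dest: bij_betw_same_card)
  also have "\<dots> = d"
  proof -
    have "out_arcs (with_proj X') x0 = Pair x0 ` {y. (x0, y) \<in> parcs X'}"
      by (auto simp: out_arcs_def)
    then have "card {y. (x0, y) \<in> parcs X'} = out_degree (with_proj X') x0"
      by (simp add: out_degree_def card_image inj_on_def)
    then show ?thesis using assms(5) x0 nbrs by (simp add: regular_def)
  qed
  finally have deg: "card {y. (x, y) \<in> parcs Y} = d" .
  obtain p where p0: "p (0\<^sub>v d) = x0"
    and p_bij: "\<And>q. q \<in> carrier_vec d \<Longrightarrow>
      bij_betw p {r. (q, r) \<in> parcs (cube d)} {y. (p q, y) \<in> parcs Y}"
    using cube_local_bijection[OF X f g Y x(1) deg] x(2) by metis
  have cube_wf: "(q, r) \<in> parcs (cube d) \<Longrightarrow> q \<in> carrier_vec d \<and> r \<in> carrier_vec d" for q r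
    by (auto simp: cube_def cayley_def)
  have p_in: "p q \<in> pverts X'" if "q \<in> carrier_vec d" for q
    using that
  proof (induction rule: cube_induct_arc)
    case (arc q r)
    then have "(p q, p r) \<in> parcs Y"
      using p_bij[of q] cube_wf[of q r] by (auto dest: bij_betwE)
    then show ?case
      using connected_component_closed[OF comp] arc X'.in_arcsD2 by blast
  qed (simp add: p0 x0)
  (* arcs of Y lift along p, so the image of p is closed under adjacency *)
  have p_onto: "v \<in> p ` carrier_vec d" if "v \<in> pverts X'" for v
    using comp sym x0 that
  proof (induction rule: connected_component_induct)
    case base
    show ?case using p0 by (metis imageI zero_carrier_vec)
  next
    case (arc u w)
    then obtain q where q: "q \<in> carrier_vec d" "u = p q" by auto
    then have "w \<in> p ` {r. (q, r) \<in> parcs (cube d)}"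
      using arc p_bij[OF q(1)] by (simp add: bij_betw_def)
    then show ?case using cube_wf by auto
  qed
  have "pverts (cube d) = carrier_vec d" by (simp add: cube_def cayley_def)
  then have "covering p (cube d) X'"
    using p_in p_onto p_bij nbrs by (auto simp: covering_def)
  moreover have "pair_fin_digraph (cube d)"
    using cubelike_imp_pair_graph[OF cubelike_cube]
    by (simp add: pair_graph_def pair_digraph_def)
  ultimately show ?thesis by (intro graph_eigenvalues_covering)
qed

end
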